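(* Let $Q$ be any quiver, let $\beta,\gamma\in\mathbb{N}^{Q_0}$ be dimension vectors, and let $\underline{\lambda}=((\lambda(a))_{a\in Q_1},(\mu(x))_{x\in Q_0},(\nu(x))_{x\in Q_0})$ be a collection of partitions associated with $(Q,\beta,\gamma)$. Then $$D(\underline{\lambda})\ \geq\ E_Q(\underline{u}_{\underline{\lambda}}).$$
   Context: A quiver $Q=(Q_0,Q_1)$ is a finite oriented graph; an arrow $a\in Q_1$ goes from its tail $ta$ to its head $ha$. The Euler form is $E_Q(\alpha)=\sum_{x\in Q_0}\alpha_x^2-\sum_{a\in Q_1}\alpha_{ta}\alpha_{ha}$ for $\alpha\in\mathbb{Z}^{Q_0}$. A partition is a non-increasing sequence of non-negative integers $\lambda=(\lambda_1,\dots,\lambda_n)$, identified with its Young diagram with $\lambda_i$ boxes in row $i$; $|\lambda|=\sum\lambda_i$; $\lambda'$ is the conjugate partition; $u_\lambda$ is the size of the Durfee square of $\lambda$ (the biggest square fitting inside the Young diagram). For a partition $\lambda=(\lambda_1,\dots,\lambda_n)$, $-\lambda$ denotes the sequence $(-\lambda_n,\dots,-\lambda_1)$. A collection $\underline{\lambda}$ associated with $(Q,\beta,\gamma)$ consists of the following: for every arrow $a$, a partition $\lambda(a)$ whose Young diagram has at most $\beta_{ta}$ rows and at most $\gamma_{ha}$ columns; and for every vertex $x$, with outgoing arrows $a_1,\dots,a_k$ and incoming arrows $b_1,\dots,b_l$, a partition $\mu(x)$ with at most $\beta_x$ rows occurring (with positive multiplicity) in the Littlewood-Richardson product of $\lambda(a_1),\dots,\lambda(a_k)$,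 and a partition $\nu(x)$ with at most $\gamma_x$ rows occurring in the Littlewood-Richardson product of $\lambda(b_1)',\dots,\lambda(b_l)'$ (an empty product gives the empty partition). A weight is a finite sequence of integers $\delta=(\delta_1,\dots,\delta_n)$. The symmetric group $\Sigma_n$ acts on weights by letting the transposition $(i,i+1)$ act as $\delta\mapsto(\delta_1,\dots,\delta_{i-1},\delta_{i+1}-1,\delta_i+1,\delta_{i+2},\dots,\delta_n)$. $N(\delta)$ is the length of the (unique) permutation $\sigma\in\Sigma_n$ such that $\sigma\cdot\delta$ is non-increasing, if one exists, and $N(\delta)=-\infty$ otherwise. In $N(-\nu(x),\mu(x))$ the weight is the concatenation of $-\nu(x)$, where $\nu(x)$ is regarded as having exactly $\gamma_x$ parts, and $\mu(x)$, regarded as having exactly $\beta_x$ parts (appending zeros if necessary). Define $$D(\underline{\lambda})=\sum_{a\in Q_1}|\lambda(a)|-\sum_{x\in Q_0}N(-\nu(x),\mu(x))$$ (so $D(\underline\lambda)=+\infty$ if some $N(-\nu(x),\mu(x))=-\infty$), and define $\underline{u}_{\underline{\lambda}}\in\mathbb{N}^{Q_0}$ by $(\underline{u}_{\underline{\lambda}})_x=\max(u_{\mu(x)},u_{\nu(x)})$. *)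

theory Defs
  imports
    "Graph_Theory.Digraph"
    "HOL-Library.FuncSet"
    "HOL-Library.Extended_Real"
    "HOL-Combinatorics.Permutations"
begin

section \<open>Quivers\<close>

text \<open>
  A quiver is a \<^locale>\<open>fin_digraph\<close>: a finite directed graph in which loops and parallel
  arrows are allowed.
\<close>

definition euler_form :: "('v, 'a) pre_digraph \<Rightarrow> ('v \<Rightarrow> int) \<Rightarrow> int" where
  "euler_form Q \<alpha> = (\<Sum>x\<in>verts Q. (\<alpha> x)\<^sup>2) - (\<Sum>a\<in>arcs Q. \<alpha> (tail Q a) * \<alpha> (head Q a))"

section \<open>Partitions\<close>

text \<open>
  Since partitions are identified with their Young diagrams, trailing zeros are immaterial. A
  partition is an eventually zero non-increasing sequence; its parts are indexed from 0, so the
  part called $\lambda_1$ in the usual notation is \<open>l 0\<close>.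
\<close>

type_synonym parts = "nat \<Rightarrow> nat"

definition is_partition :: "parts \<Rightarrow> bool" where
  "is_partition l \<longleftrightarrow> antimono l \<and> finite {i. l i \<noteq> 0}"

definition empty_partition :: parts where
  "empty_partition = (\<lambda>_. 0)"

definition young :: "parts \<Rightarrow> (nat \<times> nat) set" where
  "young l = {(i, j). j < l i}"

definition psize :: "parts \<Rightarrow> nat" where
  "psize l = (\<Sum>i\<in>{i. l i \<noteq> 0}. l i)"

definition conj_partition :: "parts \<Rightarrow> parts" where
  "conj_partition l = (\<lambda>j. card {i. (i, j) \<in> young l})"

definition at_most_rows :: "parts \<Rightarrow> nat \<Rightarrow> bool" where
  "at_most_rows l n \<longleftrightarrow> (\<forall>(i, j)\<in>young l. i < n)"

definition at_most_cols :: "parts \<Rightarrow> nat \<Rightarrow> bool" where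
  "at_most_cols l n \<longleftrightarrow> (\<forall>(i, j)\<in>young l. j < n)"

definition durfee :: "parts \<Rightarrow> nat" where
  "durfee l = (GREATEST u. {..<u} \<times> {..<u} \<subseteq> young l)"

section \<open>The Littlewood-Richardson product\<close>

text \<open>
  Littlewood-Richardson tableaux of shape \<open>n / k\<close> and content \<open>l\<close>: semistandard fillings of the
  skew diagram, with entries \<open>0, 1, 2, \<dots>\<close>, whose reading word (each row from right to left,
  rows from top to bottom) is a lattice word. A filling is extensional, i.e. it is determined by
  its values on the boxes, so that tableaux can be counted.
\<close>

definition lr_tableaux :: "parts \<Rightarrow> parts \<Rightarrow> parts \<Rightarrow> (nat \<times> nat \<Rightarrow> nat) set" where
  "lr_tableaux k l n = {T \<in> extensional (young n - young k).
     young k \<subseteq> young n \<and>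
     (\<forall>i j j'. j \<le> j' \<longrightarrow> (i, j) \<in> young n - young k \<longrightarrow> (i, j') \<in> young n - young k \<longrightarrow>
        T (i, j) \<le> T (i, j')) \<and>
     (\<forall>i i' j. i < i' \<longrightarrow> (i, j) \<in> young n - young k \<longrightarrow> (i', j) \<in> young n - young k \<longrightarrow>
        T (i, j) < T (i', j)) \<and>
     (\<forall>e. card {b \<in> young n - young k. T b = e} = l e) \<and>
     (\<forall>(r, c) \<in> young n - young k. \<forall>e.
        card {(i, j) \<in> young n - young k. (i < r \<or> i = r \<and> c \<le> j) \<and> T (i, j) = Suc e}
        \<le> card {(i, j) \<in> young n - young k. (i < r \<or> i = r \<and> c \<le> j) \<and> T (i, j) = e})}"

definition lr_coeff :: "parts \<Rightarrow> parts \<Rightarrow> parts \<Rightarrow> nat" where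
  "lr_coeff k l n = card (lr_tableaux k l n)"

text \<open>
  Multiplicity of \<open>n\<close> in the product of a list of partitions, obtained by expanding the iterated
  product. The sum is restricted to \<open>young k \<subseteq> young n\<close> to make it finite; all other coefficients
  \<open>lr_coeff k l n\<close> vanish.
\<close>

fun lr_mult :: "parts list \<Rightarrow> parts \<Rightarrow> nat" where
  "lr_mult [] n = (if n = empty_partition then 1 else 0)"
| "lr_mult (l # ls) n =
     (\<Sum>k\<in>{k. is_partition k \<and> young k \<subseteq> young n}. lr_mult ls k * lr_coeff k l n)"

text \<open>
  The Littlewood-Richardson product is commutative and associative, so the chosen enumeration of
  the finite index set \<open>A\<close> does not matter.
\<close>

definition occurs_in_lr_product :: "'a set \<Rightarrow> ('a \<Rightarrow> parts) \<Rightarrow> parts \<Rightarrow> bool" where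
  "occurs_in_lr_product A f n \<longleftrightarrow>
     is_partition n \<and> (\<exists>as. distinct as \<and> set as = A \<and> lr_mult (map f as) n > 0)"

section \<open>Collections of partitions\<close>

definition associated_collection ::
  "('v, 'a) pre_digraph \<Rightarrow> ('v \<Rightarrow> nat) \<Rightarrow> ('v \<Rightarrow> nat) \<Rightarrow>
   ('a \<Rightarrow> parts) \<Rightarrow> ('v \<Rightarrow> parts) \<Rightarrow> ('v \<Rightarrow> parts) \<Rightarrow> bool" where
  "associated_collection Q \<beta> \<gamma> lam \<mu> \<nu> \<longleftrightarrow>
     (\<forall>a\<in>arcs Q. is_partition (lam a) \<and>
        at_most_rows (lam a) (\<beta> (tail Q a)) \<and> at_most_cols (lam a) (\<gamma> (head Q a))) \<and>
     (\<forall>x\<in>verts Q. is_partition (\<mu> x) \<and> at_most_rows (\<mu> x) (\<beta> x) \<and>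
        occurs_in_lr_product (out_arcs Q x) lam (\<mu> x)) \<and>
     (\<forall>x\<in>verts Q. is_partition (\<nu> x) \<and> at_most_rows (\<nu> x) (\<gamma> x) \<and>
        occurs_in_lr_product (in_arcs Q x) (\<lambda>a. conj_partition (lam a)) (\<nu> x))"

section \<open>Weights\<close>

text \<open>
  The action of a permutation of \<open>{..<length d}\<close> on a weight: shift by $\rho = (0, -1, -2, \dots)$,
  permute the entries, shift back. The lemmas show that this is the action of the symmetric group
  that is prescribed by its values on simple transpositions.
\<close>

definition dot_action :: "(nat \<Rightarrow> nat) \<Rightarrow> int list \<Rightarrow> int list" where
  "dot_action \<sigma> d = map (\<lambda>i. d ! inv \<sigma> i - int (inv \<sigma> i) + int i) [0..<length d]"

lemma dot_action_transpose:
  assumes "Suc i < length d"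
  shows "dot_action (transpose i (Suc i)) d = d[i := d ! Suc i - 1, Suc i := d ! i + 1]"
  using assms by (intro nth_equalityI)
    (auto simp: dot_action_def nth_list_update transpose_def)

lemma dot_action_id: "dot_action id d = d"
  by (intro nth_equalityI) (auto simp: dot_action_def)

lemma dot_action_comp:
  assumes "\<sigma> permutes {..<length d}" and "\<tau> permutes {..<length d}"
  shows "dot_action (\<sigma> \<circ> \<tau>) d = dot_action \<sigma> (dot_action \<tau> d)"
proof (intro nth_equalityI)
  fix i assume "i < length (dot_action (\<sigma> \<circ> \<tau>) d)"
  then have i: "i < length d" by (simp add: dot_action_def)
  have "inv \<sigma> i < length d"
    using permutes_in_image[OF permutes_inv[OF assms(1)], of i] i by simp
  moreover have "inv (\<sigma> \<circ> \<tau>) = inv \<tau> \<circ> inv \<sigma>"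
    using assms by (intro o_inv_distrib) (auto intro: permutes_bij)
  ultimately show "dot_action (\<sigma> \<circ> \<tau>) d ! i = dot_action \<sigma> (dot_action \<tau> d) ! i"
    using i by (simp add: dot_action_def)
qed (simp add: dot_action_def)

text \<open>The Coxeter length of a permutation of \<open>{..<n}\<close>, i.e. its number of inversions.\<close>

definition perm_length :: "nat \<Rightarrow> (nat \<Rightarrow> nat) \<Rightarrow> nat" where
  "perm_length n \<sigma> = card {(i, j). i < j \<and> j < n \<and> \<sigma> j < \<sigma> i}"

definition sorts_weight :: "int list \<Rightarrow> (nat \<Rightarrow> nat) \<Rightarrow> bool" where
  "sorts_weight d \<sigma> \<longleftrightarrow> \<sigma> permutes {..<length d} \<and> sorted_wrt (\<ge>) (dot_action \<sigma> d)"

text \<open>There is at most one permutation as in the description below.\<close>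

definition N_weight :: "int list \<Rightarrow> ereal" where
  "N_weight d =
     (if \<exists>\<sigma>. sorts_weight d \<sigma>
      then ereal (real (perm_length (length d) (THE \<sigma>. sorts_weight d \<sigma>)))
      else -\<infinity>)"

text \<open>\<open>n\<close> is padded (or cut) to exactly \<open>g\<close> parts and \<open>m\<close> to exactly \<open>b\<close> parts.\<close>

definition vertex_weight :: "nat \<Rightarrow> nat \<Rightarrow> parts \<Rightarrow> parts \<Rightarrow> int list" where
  "vertex_weight g b n m =
     map (\<lambda>i. - int (n i)) (rev [0..<g]) @ map (\<lambda>i. int (m i)) [0..<b]"

definition D_value ::
  "('v, 'a) pre_digraph \<Rightarrow> ('v \<Rightarrow> nat) \<Rightarrow> ('v \<Rightarrow> nat) \<Rightarrow>
   ('a \<Rightarrow> parts) \<Rightarrow> ('v \<Rightarrow> parts) \<Rightarrow> ('v \<Rightarrow> parts) \<Rightarrow> ereal" where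
  "D_value Q \<beta> \<gamma> lam \<mu> \<nu> =
     ereal (real (\<Sum>a\<in>arcs Q. psize (lam a)))
     - (\<Sum>x\<in>verts Q. N_weight (vertex_weight (\<gamma> x) (\<beta> x) (\<nu> x) (\<mu> x)))"

definition durfee_vector :: "('v \<Rightarrow> parts) \<Rightarrow> ('v \<Rightarrow> parts) \<Rightarrow> 'v \<Rightarrow> nat" where
  "durfee_vector \<mu> \<nu> x = max (durfee (\<mu> x)) (durfee (\<nu> x))"

end

theory Submission
  imports Defs
begin

text \<open>
  Let $r_x$, $c_x$ be the Durfee sizes of $\mu(x)$, $\nu(x)$ and $u_x = \max(r_x, c_x)$. Shifting
  by $\rho$, $N(-\nu, \mu)$ counts the pairs $(q, i)$ with $\mu_q + \nu_i > q + i + 1$ and is finite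
  only if equality never occurs. These non-equalities give
  $N \le \sum_{q<r} \mu_q + \sum_{i<c} \nu_i - r^2 - c^2 + rc$. By dominance, the two sums are at most
  the total of the first $r$ rows of the outgoing and the first $c$ columns of the incoming
  $\lambda(a)$, and $|\lambda(a)|$ is at least its first $r_{ta}$ rows plus its first $c_{ha}$ columns
  minus $r_{ta} c_{ha}$. The Durfee size is subadditive under the Littlewood-Richardson product (a
  Weyl-type inequality), and this allows $\sum_a r_{ta} c_{ha}$ to be traded for
  $\sum_a u_{ta} u_{ha}$.
\<close>

section \<open>Partitions and Durfee squares\<close>

lemma is_partition_antimonoD: "is_partition l \<Longrightarrow> i \<le> j \<Longrightarrow> l j \<le> l i"
  by (auto simp: is_partition_def dest: antimonoD)

lemma finite_young:
  assumes "is_partition l"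
  shows "finite (young l)"
proof -
  have "young l \<subseteq> {i. l i \<noteq> 0} \<times> {..<l 0}"
    by (auto simp: young_def intro: less_le_trans[OF _ is_partition_antimonoD[OF assms]])
  then show ?thesis
    using assms finite_subset unfolding is_partition_def by blast
qed

lemma young_subset_iff: "young k \<subseteq> young n \<longleftrightarrow> (\<forall>i. k i \<le> n i)"
proof
  assume *: "young k \<subseteq> young n"
  show "\<forall>i. k i \<le> n i"
  proof (rule ccontr)
    assume "\<not> (\<forall>i. k i \<le> n i)"
    then obtain i where "n i < k i" by (auto simp: not_le)
    then have "(i, n i) \<in> young k" by (simp add: young_def)
    with * show False by (auto simp: young_def)
  qed
qed (auto simp: young_def intro: less_le_trans)

text \<open>The first row bounds every square inside the diagram, so the \<open>GREATEST\<close> in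
  \<open>durfee\<close> is attained.\<close>

lemma young_square_le:
  assumes "{..<u} \<times> {..<u} \<subseteq> young l"
  shows "u \<le> l 0"
proof (cases u)
  case (Suc v)
  then have "(0, v) \<in> young l" using assms by auto
  then show ?thesis using Suc by (simp add: young_def)
qed simp

lemma durfee_square_subset: "{..<durfee l} \<times> {..<durfee l} \<subseteq> young l"
  unfolding durfee_def
  using GreatestI_nat[of "\<lambda>u. {..<u} \<times> {..<u} \<subseteq> young l" 0 "l 0"] young_square_le by blast

lemma le_durfee: "{..<u} \<times> {..<u} \<subseteq> young l \<Longrightarrow> u \<le> durfee l"
  unfolding durfee_def
  using Greatest_le_nat[of "\<lambda>u. {..<u} \<times> {..<u} \<subseteq> young l" u "l 0"] young_square_le by blast

lemma durfee_le_part: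
  assumes "q < durfee l"
  shows "durfee l \<le> l q"
proof -
  have "(q, durfee l - 1) \<in> young l"
    using durfee_square_subset[of l] assms by auto
  then show ?thesis by (simp add: young_def)
qed

text \<open>Otherwise monotonicity would make rows \<open>0\<close> to \<open>durfee l\<close> all
  longer than \<open>durfee l\<close>, and a larger square would fit.\<close>

lemma part_durfee_le:
  assumes "is_partition l"
  shows "l (durfee l) \<le> durfee l"
proof (rule ccontr)
  assume "\<not> l (durfee l) \<le> durfee l"
  then have "{..<Suc (durfee l)} \<times> {..<Suc (durfee l)} \<subseteq> young l"
    using is_partition_antimonoD[OF assms, of _ "durfee l"]
    by (fastforce simp: young_def less_Suc_eq_le)
  then have "Suc (durfee l) \<le> durfee l" by (rule le_durfee)
  then show False by simp
qed

text \<open>A square of side greater than \<open>p\<close> would contain the box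
  \<open>(p, p)\<close>. The Weyl-type inequality enters bounds on Durfee sizes in this
  form.\<close>

lemma durfee_le:
  assumes "l p \<le> p"
  shows "durfee l \<le> p"
  using durfee_le_part[of p l] assms by linarith

lemma durfee_mono:
  assumes "young k \<subseteq> young n"
  shows "durfee k \<le> durfee n"
  using le_durfee[of "durfee k" n] durfee_square_subset[of k] assms by blast

lemma durfee_le_rows:
  assumes "at_most_rows l b"
  shows "durfee l \<le> b"
proof (cases "durfee l")
  case (Suc d)
  then have "(d, d) \<in> young l" using durfee_square_subset[of l] by auto
  then show ?thesis using assms Suc by (auto simp: at_most_rows_def)
qed simp

text \<open>The rows that meet column \<open>j\<close> form an initial segment, so their number
  decides membership.\<close>

lemma less_conj_partition_iff:
  assumes "is_partition l"
  shows "i < conj_partition l j \<longleftrightarrow> j < l i"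
proof -
  let ?S = "{i. j < l i}"
  have fin: "finite ?S"
    using assms unfolding is_partition_def by (auto elim: finite_subset[rotated])
  have down: "i \<in> ?S" if "i' \<in> ?S" "i \<le> i'" for i i'
    using is_partition_antimonoD[OF assms that(2)] that(1) by simp
  have c: "conj_partition l j = card ?S" by (simp add: conj_partition_def young_def)
  show ?thesis
  proof
    assume "i < conj_partition l j"
    show "j < l i"
    proof (rule ccontr)
      assume "\<not> j < l i"
      then have "?S \<subseteq> {..<i}" using down[of _ i] by (force simp: not_less[symmetric])
      then have "card ?S \<le> i" using card_mono[of "{..<i}" ?S] by simp
      with \<open>i < conj_partition l j\<close> c show False by simp
    qed
  next
    assume "j < l i"
    then have "{..i} \<subseteq> ?S" using down[of i] by auto
    then have "card {..i} \<le> card ?S" using fin card_mono by blast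
    then show "i < conj_partition l j" using c by simp
  qed
qed

lemma young_conj_partition:
  assumes "is_partition l"
  shows "young (conj_partition l) = prod.swap ` young l"
proof -
  have "(j, i) \<in> young (conj_partition l) \<longleftrightarrow> (i, j) \<in> young l" for i j
    using less_conj_partition_iff[OF assms] by (simp add: young_def)
  then show ?thesis by force
qed

lemma is_partition_conj_partition:
  assumes "is_partition l"
  shows "is_partition (conj_partition l)"
proof -
  have anti: "conj_partition l j \<le> conj_partition l i" if "i \<le> j" for i j
    using less_conj_partition_iff[OF assms, of "conj_partition l i" i]
      less_conj_partition_iff[OF assms, of "conj_partition l i" j] that
    by linarith
  have "{j. conj_partition l j \<noteq> 0} \<subseteq> {..<l 0}"
    using less_conj_partition_iff[OF assms, of 0] by auto
  then have "finite {j. conj_partition l j \<noteq> 0}" using finite_subset by blast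
  with anti show ?thesis by (auto simp: is_partition_def intro: antimonoI)
qed

lemma durfee_conj_partition:
  assumes "is_partition l"
  shows "durfee (conj_partition l) = durfee l"
proof -
  have "{..<u} \<times> {..<u} \<subseteq> prod.swap ` young l \<longleftrightarrow> {..<u} \<times> {..<u} \<subseteq> young l" for u
    by (force simp: subset_iff image_iff)
  then show ?thesis by (simp add: durfee_def young_conj_partition[OF assms])
qed

lemma card_young_rows: "(\<Sum>i<r. l i) = card {(i, j) \<in> young l. i < r}"
proof -
  have "{(i, j) \<in> young l. i < r} = (SIGMA i:{..<r}. {..<l i})"
    by (auto simp: young_def)
  then show ?thesis by simp
qed

lemma psize_eq_card_young:
  assumes "is_partition l"
  shows "psize l = card (young l)"
proof -
  have "young l = (SIGMA i:{i. l i \<noteq> 0}. {..<l i})"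
    by (auto simp: young_def)
  then show ?thesis using assms by (simp add: psize_def is_partition_def)
qed

text \<open>The first \<open>r\<close> rows and the first \<open>c\<close> columns overlap in at most \<open>r * c\<close> boxes.\<close>

lemma rows_plus_columns_le:
  assumes "is_partition l"
  shows "(\<Sum>i<r. l i) + (\<Sum>j<c. conj_partition l j) \<le> psize l + r * c"
proof -
  let ?R = "{(i, j) \<in> young l. i < r}" and ?C = "{(i, j) \<in> young l. j < c}"
  have fin: "finite ?R" "finite ?C"
    using finite_young[OF assms] by (auto elim: finite_subset[rotated])
  have "{(j, i) \<in> young (conj_partition l). j < c} = prod.swap ` ?C"
    unfolding young_conj_partition[OF assms] by force
  then have "(\<Sum>j<c. conj_partition l j) = card ?C"
    by (simp add: card_young_rows card_image inj_on_def)
  moreover have "card (?R \<union> ?C) \<le> card (young l)"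
    by (rule card_mono[OF finite_young[OF assms]]) auto
  moreover have "card (?R \<inter> ?C) \<le> card ({..<r} \<times> {..<c})"
    by (rule card_mono) auto
  ultimately show ?thesis
    using card_Un_Int[OF fin] card_young_rows[of l r] psize_eq_card_young[OF assms] by simp
qed

section \<open>Littlewood-Richardson products\<close>

context
  fixes k l n :: parts and T :: "nat \<times> nat \<Rightarrow> nat"
  assumes n: "is_partition n" and k: "is_partition k" and T: "T \<in> lr_tableaux k l n"
begin

private abbreviation "skew \<equiv> young n - young k"

lemma lr_tableau_subset: "young k \<subseteq> young n"
  and lr_tableau_row:
    "j \<le> j' \<Longrightarrow> (i, j) \<in> skew \<Longrightarrow> (i, j') \<in> skew \<Longrightarrow> T (i, j) \<le> T (i, j')"
  and lr_tableau_column: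
    "i < i' \<Longrightarrow> (i, j) \<in> skew \<Longrightarrow> (i', j) \<in> skew \<Longrightarrow> T (i, j) < T (i', j)"
  and lr_tableau_content: "card {b \<in> skew. T b = e} = l e"
  and lr_tableau_lattice: "(r, c) \<in> skew \<Longrightarrow>
     card {(i, j) \<in> skew. (i < r \<or> i = r \<and> c \<le> j) \<and> T (i, j) = Suc e}
     \<le> card {(i, j) \<in> skew. (i < r \<or> i = r \<and> c \<le> j) \<and> T (i, j) = e}"
  using T unfolding lr_tableaux_def by blast+

lemma finite_skew: "finite skew"
  using finite_young[OF n] by simp

text \<open>By the lattice condition an entry \<open>Suc e\<close> is preceded in the reading word
  by an \<open>e\<close>. Rows increase weakly, so that \<open>e\<close> lies in a strictly earlier
  row, and induction applies.\<close>

lemma lr_tableau_entry_le_row: "(i, j) \<in> skew \<Longrightarrow> T (i, j) \<le> i"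
proof (induction i arbitrary: j rule: less_induct)
  case (less i)
  show ?case
  proof (rule ccontr)
    assume "\<not> T (i, j) \<le> i"
    then obtain e where e: "T (i, j) = Suc e" "i \<le> e" by (cases "T (i, j)") auto
    let ?B = "\<lambda>e. {(i', j') \<in> skew. (i' < i \<or> i' = i \<and> j \<le> j') \<and> T (i', j') = e}"
    have "(i, j) \<in> ?B (Suc e)" using less.prems e by auto
    moreover have "finite (?B (Suc e))" using finite_skew by (auto elim: finite_subset[rotated])
    ultimately have "card (?B (Suc e)) > 0" by (auto simp only: card_gt_0_iff)
    then have "card (?B e) > 0" using lr_tableau_lattice[OF less.prems, of e] by linarith
    then have "?B e \<noteq> {}" unfolding card_gt_0_iff by (rule conjunct1)
    then obtain i' j' where b: "(i', j') \<in> skew" "T (i', j') = e"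
      and "i' < i \<or> i' = i \<and> j \<le> j'"
      by auto
    then consider "i' < i" | "i' = i" "j \<le> j'" by blast
    then show False
    proof cases
      case 1
      then show ?thesis using less.IH[OF 1 b(1)] b(2) e by simp
    next
      case 2
      then show ?thesis using lr_tableau_row[of j j' i] less.prems b e by simp
    qed
  qed
qed

text \<open>Skew boxes in the first \<open>r\<close> rows carry entries below \<open>r\<close>, and
  the content bounds the number of such entries. This is the dominance inequality.\<close>

lemma lr_tableau_sum_rows_le: "(\<Sum>i<r. n i) \<le> (\<Sum>i<r. k i) + (\<Sum>i<r. l i)"
proof -
  let ?N = "{(i, j) \<in> young n. i < r}" and ?K = "{(i, j) \<in> young k. i < r}"
  have "?N \<subseteq> ?K \<union> (\<Union>e<r. {b \<in> skew. T b = e})"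
    using lr_tableau_entry_le_row by fastforce
  moreover have "finite ?K" "finite (\<Union>e<r. {b \<in> skew. T b = e})"
    using finite_skew finite_young[OF k] by (auto elim: finite_subset[rotated])
  ultimately have "card ?N \<le> card ?K + card (\<Union>e<r. {b \<in> skew. T b = e})"
    by (meson card_Un_le card_mono finite_UnI le_trans)
  moreover have "card (\<Union>e<r. {b \<in> skew. T b = e}) \<le> (\<Sum>e<r. card {b \<in> skew. T b = e})"
    by (rule card_UN_le) simp
  ultimately show ?thesis unfolding lr_tableau_content card_young_rows by linarith
qed

text \<open>Strict columns contain \<open>e\<close> at most once, and a column containing
  \<open>e\<close> does so in a row \<open>i\<close> with \<open>e \<le> i\<close>; hence it is one
  of the first \<open>n e\<close> columns.\<close>

lemma lr_tableau_content_le: "l e \<le> n e"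
proof -
  let ?E = "{b \<in> skew. T b = e}"
  have same_row: "i = i'" if "(i, j) \<in> ?E" "(i', j) \<in> ?E" for i i' j
    using lr_tableau_column[of i i' j] lr_tableau_column[of i' i j] that
    by (cases i i' rule: linorder_cases) auto
  have "inj_on snd ?E"
  proof (rule inj_onI)
    fix b b' assume b: "b \<in> ?E" "b' \<in> ?E" "snd b = snd b'"
    obtain i j i' j' where "b = (i, j)" "b' = (i', j')" by (metis surj_pair)
    then show "b = b'" using b same_row[of i j i'] by simp
  qed
  moreover have "snd ` ?E \<subseteq> {..<n e}"
  proof
    fix j assume "j \<in> snd ` ?E"
    then obtain i where i: "(i, j) \<in> skew" "T (i, j) = e" by auto
    then have "n i \<le> n e"
      using lr_tableau_entry_le_row[OF i(1)] by (intro is_partition_antimonoD[OF n]) simp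
    then show "j \<in> {..<n e}" using i(1) by (auto simp: young_def)
  qed
  ultimately have "card ?E \<le> card {..<n e}" by (intro card_inj_on_le[of snd]) auto
  then show ?thesis unfolding lr_tableau_content by simp
qed

text \<open>
  Reading row \<open>R\<close> from right to left, the lattice condition shows by descending induction on \<open>e\<close>
  that the first \<open>R + 1\<close> rows contain at least as many \<open>e\<close> as row \<open>R\<close> contains entries \<open>\<ge> e\<close>.
\<close>

lemma lr_tableau_row_entries_ge:
  "card {(i, j) \<in> skew. i = R \<and> q \<le> T (i, j)} \<le> l q"
proof -
  let ?U = "\<lambda>e. {(i, j) \<in> skew. i < R \<and> T (i, j) = e}"
  let ?r = "\<lambda>e. {(i, j) \<in> skew. i = R \<and> T (i, j) = e}"
  let ?G = "\<lambda>e. {(i, j) \<in> skew. i = R \<and> e \<le> T (i, j)}"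
  have fin: "finite (?U e)" "finite (?r e)" "finite (?G e)" for e
    by (rule finite_subset[OF _ finite_skew], auto)+
  have lattice: "card (?U (Suc e)) + card (?r (Suc e)) \<le> card (?U e)" if "?G (Suc e) \<noteq> {}" for e
  proof -
    let ?P = "\<lambda>c. (R, c) \<in> skew \<and> Suc e \<le> T (R, c)"
    \<comment> \<open>The reading word, cut off at the leftmost entry of row \<open>R\<close>
      exceeding \<open>e\<close>, has met every \<open>Suc e\<close> of that row but none of its
      entries \<open>e\<close>.\<close>
    define c where "c = (LEAST c. ?P c)"
    have "\<exists>c. ?P c" using that by auto
    then have c: "?P c" unfolding c_def by (rule LeastI_ex)
    have c_le: "c \<le> j" if "?P j" for j unfolding c_def using that by (rule Least_le)
    let ?B = "\<lambda>e. {(i, j) \<in> skew. (i < R \<or> i = R \<and> c \<le> j) \<and> T (i, j) = e}"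
    have "?B (Suc e) = ?U (Suc e) \<union> ?r (Suc e)" using c_le by auto
    moreover have "?U (Suc e) \<inter> ?r (Suc e) = {}" by auto
    ultimately have "card (?B (Suc e)) = card (?U (Suc e)) + card (?r (Suc e))"
      using card_Un_disjoint[OF fin(1,2)] by simp
    moreover have "?B e = ?U e"
    proof -
      have "T (R, j) \<noteq> e" if "(R, j) \<in> skew" "c \<le> j" for j
        using lr_tableau_row[OF that(2) _ that(1)] c by force
      then show ?thesis by auto
    qed
    moreover have "card (?B (Suc e)) \<le> card (?B e)"
      using lr_tableau_lattice[of R c e] c by simp
    ultimately show ?thesis by simp
  qed
  have empty: "?G e = {}" if "R < e" for e
  proof -
    have "T (R, j) < e" if "(R, j) \<in> skew" for j
      using lr_tableau_entry_le_row[OF that] \<open>R < e\<close> by simp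
    then show ?thesis by fastforce
  qed
  \<comment> \<open>The descent starts at \<open>Suc R\<close>, since row \<open>R\<close> has no
    entry above \<open>R\<close>. In the step, \<open>lattice\<close> absorbs the count for
    \<open>Suc e\<close> into \<open>?U e\<close>, and the entries \<open>e\<close> of row
    \<open>R\<close> contribute the same term to both sides.\<close>
  have main: "card (?G e) \<le> card (?U e) + card (?r e)" if "e \<le> Suc R" for e
    using that
  proof (induction e rule: inc_induct)
    case base
    show ?case unfolding empty[OF lessI] card.empty by simp
  next
    case (step e)
    have G: "card (?G e) = card (?G (Suc e)) + card (?r e)"
    proof -
      have "?G e = ?G (Suc e) \<union> ?r e" "?G (Suc e) \<inter> ?r e = {}" by auto
      then show ?thesis using card_Un_disjoint[OF fin(3,2), of "Suc e" e] by simp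
    qed
    show ?case
    proof (cases "?G (Suc e) = {}")
      case True
      then show ?thesis using G unfolding True card.empty by linarith
    next
      case False
      then show ?thesis using G step.IH lattice[OF False] by linarith
    qed
  qed
  have "card (?G q) \<le> card (?U q) + card (?r q)"
  proof (cases "q \<le> Suc R")
    case False
    then have "R < q" by simp
    then show ?thesis unfolding empty[OF \<open>R < q\<close>] card.empty by simp
  qed (rule main)
  also have "\<dots> = card (?U q \<union> ?r q)"
    by (rule card_Un_disjoint[symmetric]) (use fin in auto)
  also have "\<dots> \<le> card {b \<in> skew. T b = q}"
    by (rule card_mono[OF finite_subset[OF _ finite_skew]]) auto
  finally show ?thesis unfolding lr_tableau_content .
qed

text \<open>Each column from \<open>k p\<close> up to \<open>n (p + q)\<close> has skew boxes in all
  rows from \<open>p\<close> to \<open>p + q\<close>. Strictness makes the lowest of these entries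
  at least \<open>q\<close>, and row \<open>p + q\<close> has at most \<open>l q\<close> such
  entries.\<close>

lemma lr_tableau_weyl: "n (p + q) \<le> k p + l q"
proof -
  let ?G = "{(i, j) \<in> skew. i = p + q \<and> q \<le> T (i, j)}"
  have "(p + q, j) \<in> ?G" if "k p \<le> j" "j < n (p + q)" for j
  proof -
    have box: "(p + d, j) \<in> skew" if "d \<le> q" for d
      using is_partition_antimonoD[OF k, of p "p + d"] is_partition_antimonoD[OF n, of "p + d" "p + q"]
        that \<open>k p \<le> j\<close> \<open>j < n (p + q)\<close> by (auto simp: young_def)
    have "d \<le> T (p + d, j)" if "d \<le> q" for d
      using that
    proof (induction d)
      case (Suc d)
      then show ?case using lr_tableau_column[of "p + d" "p + Suc d" j] box[of d] box[of "Suc d"]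
        by fastforce
    qed simp
    with box show ?thesis by simp
  qed
  then have "(\<lambda>j. (p + q, j)) ` {k p..<n (p + q)} \<subseteq> ?G" by auto
  moreover have "finite ?G" using finite_skew by (auto elim: finite_subset[rotated])
  ultimately have "card ((\<lambda>j. (p + q, j)) ` {k p..<n (p + q)}) \<le> card ?G"
    by (intro card_mono)
  then show ?thesis
    using lr_tableau_row_entries_ge[of "p + q" q] by (simp add: card_image inj_on_def)
qed

end

section \<open>Iterated products\<close>

lemma lr_mult_ConsE:
  assumes "lr_mult (l # ls) n > 0"
  obtains k T where "is_partition k" "lr_mult ls k > 0" "T \<in> lr_tableaux k l n"
proof -
  have "\<exists>k. is_partition k \<and> lr_mult ls k * lr_coeff k l n \<noteq> 0"
  proof (rule ccontr)
    assume "\<not> ?thesis"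
    then have "lr_mult (l # ls) n = 0" unfolding lr_mult.simps by (intro sum.neutral) auto
    with assms show False by simp
  qed
  then obtain k where k: "is_partition k" and pos: "lr_mult ls k * lr_coeff k l n \<noteq> 0" by blast
  then have "lr_tableaux k l n \<noteq> {}" by (auto simp: lr_coeff_def)
  then show ?thesis using that k pos by auto
qed

lemma lr_mult_sum_rows_le:
  assumes "is_partition n" "lr_mult ls n > 0"
  shows "(\<Sum>i<r. n i) \<le> (\<Sum>l\<leftarrow>ls. \<Sum>i<r. l i)"
  using assms
proof (induction ls arbitrary: n)
  case Nil
  then show ?case by (simp add: empty_partition_def split: if_splits)
next
  case (Cons l ls)
  from Cons.prems(2) obtain k T
    where "is_partition k" "lr_mult ls k > 0" "T \<in> lr_tableaux k l n" by (rule lr_mult_ConsE)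
  then show ?case
    using Cons.IH[of k] lr_tableau_sum_rows_le[OF Cons.prems(1), of k T l r] by simp
qed

lemma lr_mult_factor_subset:
  assumes "is_partition n" "lr_mult ls n > 0" "l \<in> set ls"
  shows "young l \<subseteq> young n"
  using assms
proof (induction ls arbitrary: n)
  case (Cons l' ls)
  from Cons.prems(2) obtain k T
    where "is_partition k" "lr_mult ls k > 0" "T \<in> lr_tableaux k l' n" by (rule lr_mult_ConsE)
  then show ?case
    using Cons.IH[of k] Cons.prems lr_tableau_content_le[OF Cons.prems(1), of k T l']
      lr_tableau_subset[OF Cons.prems(1), of k T l']
    by (auto simp: young_subset_iff intro: le_trans)
qed simp

text \<open>The Weyl-type inequality at \<open>p = durfee k\<close>, \<open>q = durfee l\<close>
  gives \<open>n (p + q) \<le> p + q\<close>, so Durfee sizes are subadditive; then induct on the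
  list.\<close>

lemma lr_mult_durfee_le:
  assumes "is_partition n" "lr_mult ls n > 0" "\<And>l. l \<in> set ls \<Longrightarrow> is_partition l"
  shows "durfee n \<le> (\<Sum>l\<leftarrow>ls. durfee l)"
  using assms
proof (induction ls arbitrary: n)
  case Nil
  then show ?case using durfee_le[of n 0] by (auto simp: empty_partition_def split: if_splits)
next
  case (Cons l ls)
  from Cons.prems(2) obtain k T
    where k: "is_partition k" "lr_mult ls k > 0" "T \<in> lr_tableaux k l n" by (rule lr_mult_ConsE)
  have "n (durfee k + durfee l) \<le> k (durfee k) + l (durfee l)"
    using lr_tableau_weyl[OF Cons.prems(1) k(1) k(3)] .
  also have "\<dots> \<le> durfee k + durfee l"
    using part_durfee_le[OF k(1)] part_durfee_le[of l] Cons.prems(3) by (simp add: add_mono)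
  finally have "durfee n \<le> durfee k + durfee l" by (rule durfee_le)
  then show ?case using Cons.IH[of k] k Cons.prems(3) by fastforce
qed

lemma occurs_in_lr_product_sum_rows_le:
  assumes "occurs_in_lr_product A f n"
  shows "(\<Sum>i<r. n i) \<le> (\<Sum>a\<in>A. \<Sum>i<r. f a i)"
proof -
  obtain as where as: "distinct as" "set as = A" "lr_mult (map f as) n > 0" and "is_partition n"
    using assms unfolding occurs_in_lr_product_def by blast
  then show ?thesis
    using lr_mult_sum_rows_le[of n "map f as" r]
    by (simp add: o_def sum_list_distinct_conv_sum_set)
qed

lemma occurs_in_lr_product_durfee_factor_le:
  assumes "occurs_in_lr_product A f n" "a \<in> A"
  shows "durfee (f a) \<le> durfee n"
proof (rule durfee_mono)
  show "young (f a) \<subseteq> young n"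
    using assms lr_mult_factor_subset[of n _ "f a"] unfolding occurs_in_lr_product_def
    by (metis image_eqI list.set_map)
qed

lemma occurs_in_lr_product_durfee_le:
  assumes "occurs_in_lr_product A f n" "\<And>a. a \<in> A \<Longrightarrow> is_partition (f a)"
  shows "durfee n \<le> (\<Sum>a\<in>A. durfee (f a))"
proof -
  obtain as where as: "distinct as" "set as = A" "lr_mult (map f as) n > 0" and "is_partition n"
    using assms unfolding occurs_in_lr_product_def by blast
  then show ?thesis
    using lr_mult_durfee_le[of n "map f as"] assms(2)
    by (auto simp: o_def sum_list_distinct_conv_sum_set)
qed

section \<open>Lengths of sorting permutations\<close>

context
  fixes d :: "int list" and \<sigma> :: "nat \<Rightarrow> nat"
  assumes \<sigma>: "sorts_weight d \<sigma>"
begin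

text \<open>The action permutes the shifted entries \<open>d ! i - int i\<close>. A non-increasing
  weight becomes strictly decreasing after the shift, so \<open>\<sigma>\<close> lists the shifted
  entries in strictly decreasing order.\<close>

lemma sorts_weight_less_iff:
  assumes "i < length d" "j < length d"
  shows "\<sigma> j < \<sigma> i \<longleftrightarrow> d ! i - int i < d ! j - int j"
proof -
  have perm: "\<sigma> permutes {..<length d}"
    and sorted: "sorted_wrt (\<ge>) (dot_action \<sigma> d)"
    using \<sigma> by (auto simp: sorts_weight_def)
  have less: "d ! y - int y < d ! x - int x"
    if "x < length d" "y < length d" "\<sigma> x < \<sigma> y" for x y
  proof -
    have "\<sigma> x < length d" "\<sigma> y < length d"
      using permutes_in_image[OF perm] that by auto
    moreover from this have "dot_action \<sigma> d ! \<sigma> y \<le> dot_action \<sigma> d ! \<sigma> x"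
      using sorted_wrt_nth_less[OF sorted that(3)] by (simp add: dot_action_def)
    ultimately show ?thesis
      using that(3) permutes_inverses(2)[OF perm] by (simp add: dot_action_def)
  qed
  show ?thesis
    using less[of i j] less[of j i] assms permutes_inj[OF perm]
    by (metis injD less_asym' linorder_neqE_nat)
qed

lemma sorts_weight_distinct:
  assumes "i < length d" "j < length d" "i \<noteq> j"
  shows "d ! i - int i \<noteq> d ! j - int j"
proof
  assume "d ! i - int i = d ! j - int j"
  then have "\<sigma> i = \<sigma> j"
    using sorts_weight_less_iff[OF assms(1,2)] sorts_weight_less_iff[OF assms(2,1)] by auto
  moreover have "inj \<sigma>" using \<sigma> by (auto simp: sorts_weight_def dest: permutes_inj)
  ultimately show False using assms(3) by (auto dest: injD)
qed

text \<open>The position of an entry is its rank, so \<open>d\<close> determines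
  \<open>\<sigma>\<close>; this justifies the \<open>THE\<close> in \<open>N_weight\<close>.\<close>

lemma sorts_weight_eq_card:
  assumes "i < length d"
  shows "\<sigma> i = card {j. j < length d \<and> d ! i - int i < d ! j - int j}"
proof -
  have perm: "\<sigma> permutes {..<length d}" using \<sigma> by (auto simp: sorts_weight_def)
  have "\<sigma> ` {j. j < length d \<and> d ! i - int i < d ! j - int j} = {..<\<sigma> i}" (is "\<sigma> ` ?S = _")
  proof
    show "\<sigma> ` ?S \<subseteq> {..<\<sigma> i}" using sorts_weight_less_iff[OF assms] by auto
    show "{..<\<sigma> i} \<subseteq> \<sigma> ` ?S"
    proof
      fix m assume "m \<in> {..<\<sigma> i}"
      moreover have "\<sigma> i < length d" using permutes_in_image[OF perm] assms by simp
      ultimately have "m \<in> \<sigma> ` {..<length d}" using permutes_image[OF perm] by auto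
      then obtain j where "j < length d" "m = \<sigma> j" by auto
      then show "m \<in> \<sigma> ` ?S"
        using sorts_weight_less_iff[OF assms, of j] \<open>m \<in> {..<\<sigma> i}\<close> by auto
    qed
  qed
  moreover have "inj_on \<sigma> ?S" using permutes_inj[OF perm] inj_on_subset by blast
  ultimately show ?thesis by (metis card_image card_lessThan)
qed

end

lemma sorts_weight_unique:
  assumes "sorts_weight d \<sigma>" "sorts_weight d \<tau>"
  shows "\<sigma> = \<tau>"
proof
  fix i
  show "\<sigma> i = \<tau> i"
  proof (cases "i < length d")
    case True
    then show ?thesis using assms by (simp add: sorts_weight_eq_card)
  next
    case False
    then show ?thesis using assms by (simp add: sorts_weight_def permutes_def)
  qed
qed

lemma N_weight_eq_inversions:
  assumes "sorts_weight d \<sigma>"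
  shows "N_weight d =
    ereal (real (card {(i, j). i < j \<and> j < length d \<and> d ! i - int i < d ! j - int j}))"
proof -
  have "(THE \<sigma>. sorts_weight d \<sigma>) = \<sigma>"
    using assms sorts_weight_unique by blast
  moreover have "{(i, j). i < j \<and> j < length d \<and> \<sigma> j < \<sigma> i} =
      {(i, j). i < j \<and> j < length d \<and> d ! i - int i < d ! j - int j}"
    using sorts_weight_less_iff[OF assms] by auto
  ultimately show ?thesis using assms by (auto simp: N_weight_def perm_length_def)
qed

section \<open>The estimate at a vertex\<close>

text \<open>The inversion condition reads \<open>i - n i < m q - Suc q\<close>. The left sides are
  distinct for \<open>i\<close> beyond the Durfee square of \<open>n\<close>, and \<open>neq\<close>
  keeps them away from every \<open>m p - Suc p\<close> with \<open>p < durfee m\<close>. Those with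
  \<open>q < p\<close> remove \<open>durfee m - Suc q\<close> distinct candidates.\<close>

lemma card_inversions_in_row_le:
  assumes m: "is_partition m" and n: "is_partition n" and b: "durfee m \<le> b"
    and neq: "\<And>q i. q < b \<Longrightarrow> i < g \<Longrightarrow> m q + n i \<noteq> q + i + 1"
    and q: "q < durfee m"
  shows "card {i. durfee n \<le> i \<and> i < g \<and> q + i + 1 < m q + n i} \<le> m q - durfee m"
proof -
  let ?S = "{i. durfee n \<le> i \<and> i < g \<and> q + i + 1 < m q + n i}"
  let ?A = "\<lambda>q. m q - Suc q" and ?B = "\<lambda>i. i - n i"
  \<comment> \<open>These two bounds make the truncated subtractions in \<open>?A\<close> and
    \<open>?B\<close> exact.\<close>
  have A: "Suc p \<le> m p" if "p < durfee m" for p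
    using durfee_le_part[OF that] that by linarith
  have B: "n i \<le> i" if "durfee n \<le> i" for i
    using is_partition_antimonoD[OF n that] part_durfee_le[OF n] that by linarith
  have A_less: "?A p' < ?A p" if "p < p'" "p' < durfee m" for p p'
    using is_partition_antimonoD[OF m, of p p'] A[of p] A[of p'] that by linarith
  have "inj_on ?B ?S"
  proof (rule linorder_inj_onI')
    fix i j assume "i \<in> ?S" "j \<in> ?S" "i < j"
    then show "?B i \<noteq> ?B j"
      using is_partition_antimonoD[OF n, of i j] B[of i] B[of j] by fastforce
  qed
  moreover have "?B ` ?S \<subseteq> {..<?A q} - ?A ` {q<..<durfee m}"
  proof
    fix y assume "y \<in> ?B ` ?S"
    then obtain i where i: "durfee n \<le> i" "i < g" "q + i + 1 < m q + n i" "y = i - n i" by auto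
    have ne: "y \<noteq> ?A p" if "p < durfee m" for p
      using i B[of i] A[OF that] neq[of p i] b that by linarith
    have "y < ?A q" using i B[of i] by linarith
    moreover have "y \<notin> ?A ` {q<..<durfee m}"
    proof
      assume "y \<in> ?A ` {q<..<durfee m}"
      then obtain p where "p < durfee m" "y = ?A p" by auto
      with ne show False by blast
    qed
    ultimately show "y \<in> {..<?A q} - ?A ` {q<..<durfee m}" by simp
  qed
  ultimately have "card ?S \<le> card ({..<?A q} - ?A ` {q<..<durfee m})"
    by (intro card_inj_on_le) auto
  also have "\<dots> = ?A q - card (?A ` {q<..<durfee m})"
    using A_less[of q] by (subst card_Diff_subset) auto
  also have "card (?A ` {q<..<durfee m}) = card {q<..<durfee m}"
    using A_less by (intro card_image linorder_inj_onI') (metis greaterThanLessThan_iff less_irrefl)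
  \<comment> \<open>\<open>(m q - Suc q) - (durfee m - Suc q) = m q - durfee m\<close>.\<close>
  finally show ?thesis using q by simp
qed

text \<open>No inversion has both indices beyond the Durfee squares. Those with both inside number
  at most \<open>durfee m * durfee n\<close>; the two mixed regions are counted row by row, the
  second with \<open>m\<close> and \<open>n\<close> exchanged.\<close>

lemma card_inversions_le:
  assumes m: "is_partition m" and n: "is_partition n"
    and b: "durfee m \<le> b" and g: "durfee n \<le> g"
    and neq: "\<And>q i. q < b \<Longrightarrow> i < g \<Longrightarrow> m q + n i \<noteq> q + i + 1"
  shows "card {(q, i). q < b \<and> i < g \<and> q + i + 1 < m q + n i} + (durfee m)\<^sup>2 + (durfee n)\<^sup>2
    \<le> (\<Sum>q<durfee m. m q) + (\<Sum>i<durfee n. n i) + durfee m * durfee n"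
proof -
  let ?r = "durfee m" and ?c = "durfee n"
  let ?R = "\<lambda>q. {i. ?c \<le> i \<and> i < g \<and> q + i + 1 < m q + n i}"
  let ?C = "\<lambda>i. {q. ?r \<le> q \<and> q < b \<and> i + q + 1 < n i + m q}"
  let ?X = "{(q, i). q < b \<and> i < g \<and> q + i + 1 < m q + n i}"
  have sub: "?X \<subseteq> {..<?r} \<times> {..<?c} \<union> (SIGMA q:{..<?r}. ?R q)
    \<union> prod.swap ` (SIGMA i:{..<?c}. ?C i)" (is "_ \<subseteq> ?X1 \<union> ?X2 \<union> ?X3")
  proof
    fix p assume "p \<in> ?X"
    then obtain q i where p: "p = (q, i)" and *: "q < b" "i < g" "q + i + 1 < m q + n i" by auto
    have "q < ?r \<or> i < ?c"
    proof (rule ccontr)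
      assume "\<not> ?thesis"
      then show False
        using is_partition_antimonoD[OF m, of ?r q] is_partition_antimonoD[OF n, of ?c i]
          part_durfee_le[OF m] part_durfee_le[OF n] * by linarith
    qed
    then consider "q < ?r" "i < ?c" | "q < ?r" "?c \<le> i" | "?r \<le> q" "i < ?c" by linarith
    then show "p \<in> ?X1 \<union> ?X2 \<union> ?X3"
    proof cases
      case 1
      then show ?thesis using p by simp
    next
      case 2
      then have "(q, i) \<in> ?X2" using * by simp
      then show ?thesis unfolding p by blast
    next
      case 3
      then have "(i, q) \<in> (SIGMA i:{..<?c}. ?C i)" using * by auto
      then have "prod.swap (i, q) \<in> ?X3" by (rule imageI)
      then show ?thesis unfolding p swap_simp by blast
    qed
  qed
  have fin: "finite ?X1" "finite ?X2" "finite ?X3" by auto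
  have "card ?X \<le> card ?X1 + card ?X2 + card ?X3"
    using card_mono[OF _ sub] fin card_Un_le[of ?X1 ?X2] card_Un_le[of "?X1 \<union> ?X2" ?X3]
    by fastforce
  moreover have "card ?X2 + ?r\<^sup>2 \<le> (\<Sum>q<?r. m q)"
  proof -
    have "card (?R q) + ?r \<le> m q" if "q < ?r" for q
    proof -
      have "card (?R q) \<le> m q - ?r"
        by (rule card_inversions_in_row_le[OF m n b _ that]) (rule neq)
      then show ?thesis using durfee_le_part[OF that] by linarith
    qed
    then have "(\<Sum>q<?r. card (?R q) + ?r) \<le> (\<Sum>q<?r. m q)" by (intro sum_mono) auto
    then show ?thesis by (simp add: sum.distrib power2_eq_square)
  qed
  moreover have "card ?X3 + ?c\<^sup>2 \<le> (\<Sum>i<?c. n i)"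
  proof -
    have "card (?C i) + ?c \<le> n i" if "i < ?c" for i
    proof -
      have "card (?C i) \<le> n i - ?c"
      proof (rule card_inversions_in_row_le[OF n m g _ that])
        show "n i + m q \<noteq> i + q + 1" if "i < g" "q < b" for i q
          using neq[OF that(2,1)] by linarith
      qed
      then show ?thesis using durfee_le_part[OF that] by linarith
    qed
    then have "(\<Sum>i<?c. card (?C i) + ?c) \<le> (\<Sum>i<?c. n i)" by (intro sum_mono) auto
    then show ?thesis by (simp add: sum.distrib power2_eq_square card_image)
  qed
  ultimately show ?thesis by simp
qed

lemma N_weight_vertex_weight_le:
  assumes m: "is_partition m" "at_most_rows m b" and n: "is_partition n" "at_most_rows n g"
  shows "N_weight (vertex_weight g b n m) \<le>
    ereal (real_of_int (int (\<Sum>q<durfee m. m q) + int (\<Sum>i<durfee n. n i)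
      + int (durfee m) * int (durfee n) - (int (durfee m))\<^sup>2 - (int (durfee n))\<^sup>2))"
proof (cases "\<exists>\<sigma>. sorts_weight (vertex_weight g b n m) \<sigma>")
  case True
  let ?d = "vertex_weight g b n m"
  obtain \<sigma> where \<sigma>: "sorts_weight ?d \<sigma>" using True by blast
  have len: "length ?d = g + b" by (simp add: vertex_weight_def)
  \<comment> \<open>The negated half is stored in reverse, so part \<open>i\<close> of
    \<open>n\<close> sits at position \<open>g - Suc i\<close>. Comparing it with position
    \<open>g + q\<close> then turns the shifts into \<open>q + i + 1\<close>.\<close>
  have left: "?d ! (g - Suc i) = - int (n i)" if "i < g" for i
    using that by (simp add: vertex_weight_def nth_append rev_nth)
  have left': "?d ! p = - int (n (g - Suc p))" if "p < g" for p
    using that left[of "g - Suc p"] by simp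
  have right: "?d ! (g + q) = int (m q)" if "q < b" for q
    using that by (simp add: vertex_weight_def nth_append)
  have neq: "m q + n i \<noteq> q + i + 1" if "q < b" "i < g" for q i
  proof -
    have "?d ! (g - Suc i) - int (g - Suc i) \<noteq> ?d ! (g + q) - int (g + q)"
      by (rule sorts_weight_distinct[OF \<sigma>]) (use that len in auto)
    then show ?thesis using that left[OF that(2)] right[OF that(1)] by auto
  qed
  let ?I = "{(i, j). i < j \<and> j < length ?d \<and> ?d ! i - int i < ?d ! j - int j}"
  let ?X = "{(q, i). q < b \<and> i < g \<and> q + i + 1 < m q + n i}"
  let ?h = "\<lambda>(i, j). (j - g, g - Suc i)"
  \<comment> \<open>Each half is already non-increasing, so its shifted entries strictly decrease
    and inversions only cross between the halves.\<close>
  have I: "i < g \<and> g \<le> j" if "(i, j) \<in> ?I" for i j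
  proof (rule ccontr)
    assume "\<not> ?thesis"
    with that consider "j < g" "i < j" | "g \<le> i" "i < j" "j < g + b" using len by auto
    then show False
    proof cases
      case 1
      then have "n (g - Suc i) \<le> n (g - Suc j)" by (intro is_partition_antimonoD[OF n(1)]) simp
      then show ?thesis using that 1 left'[of i] left'[of j] by auto
    next
      case 2
      then have "m (j - g) \<le> m (i - g)" by (intro is_partition_antimonoD[OF m(1)]) simp
      moreover have "?d ! i = int (m (i - g))" "?d ! j = int (m (j - g))"
        using 2 right[of "i - g"] right[of "j - g"] by auto
      ultimately show ?thesis using that 2 by auto
    qed
  qed
  have "card ?I \<le> card ?X"
  proof (rule card_inj_on_le[of ?h])
    show "inj_on ?h ?I"
    proof (rule inj_onI, clarify)
      fix i j i' j'
      assume *: "i < j" "j < length ?d" "?d ! i - int i < ?d ! j - int j"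
        "i' < j'" "j' < length ?d" "?d ! i' - int i' < ?d ! j' - int j'"
        and eq: "j - g = j' - g" "g - Suc i = g - Suc i'"
      have "i < g \<and> g \<le> j" "i' < g \<and> g \<le> j'" using * I by auto
      with eq show "i = i' \<and> j = j'" by auto
    qed
    show "?h ` ?I \<subseteq> ?X"
    proof clarify
      fix i j assume *: "i < j" "j < length ?d" "?d ! i - int i < ?d ! j - int j"
      have **: "i < g" "g \<le> j" using * I[of i j] by auto
      then show "j - g < b \<and> g - Suc i < g \<and> j - g + (g - Suc i) + 1 < m (j - g) + n (g - Suc i)"
        using * left'[of i] right[of "j - g"] len by auto
    qed
    have "?X \<subseteq> {..<b} \<times> {..<g}" by auto
    then show "finite ?X" using finite_subset by blast
  qed
  then have "card ?I + (durfee m)\<^sup>2 + (durfee n)\<^sup>2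
    \<le> (\<Sum>q<durfee m. m q) + (\<Sum>i<durfee n. n i) + durfee m * durfee n"
    using card_inversions_le[OF m(1) n(1) durfee_le_rows[OF m(2)] durfee_le_rows[OF n(2)]] neq
    by (meson add_right_mono le_trans)
  then have "int (card ?I) \<le> int (\<Sum>q<durfee m. m q) + int (\<Sum>i<durfee n. n i)
      + int (durfee m) * int (durfee n) - (int (durfee m))\<^sup>2 - (int (durfee n))\<^sup>2"
    unfolding of_nat_power[symmetric] of_nat_mult[symmetric] by linarith
  then have "real_of_int (int (card ?I)) \<le> real_of_int (int (\<Sum>q<durfee m. m q) + int (\<Sum>i<durfee n. n i)
      + int (durfee m) * int (durfee n) - (int (durfee m))\<^sup>2 - (int (durfee n))\<^sup>2)"
    by (rule of_int_le_iff[THEN iffD2])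
  then show ?thesis unfolding N_weight_eq_inversions[OF \<sigma>] by simp
next
  case False
  then show ?thesis by (simp add: N_weight_def)
qed

section \<open>Summation over the quiver\<close>

context fin_digraph
begin

lemma sum_out_arcs: "(\<Sum>x\<in>verts G. \<Sum>a\<in>out_arcs G x. f a) = (\<Sum>a\<in>arcs G. f a)"
proof -
  have "tail G ` arcs G \<subseteq> verts G" by auto
  then show ?thesis
    using sum.group[of "arcs G" "verts G" "tail G" f] by (simp add: out_arcs_def)
qed

lemma sum_in_arcs: "(\<Sum>x\<in>verts G. \<Sum>a\<in>in_arcs G x. f a) = (\<Sum>a\<in>arcs G. f a)"
proof -
  have "head G ` arcs G \<subseteq> verts G" by auto
  then show ?thesis
    using sum.group[of "arcs G" "verts G" "head G" f] by (simp add: in_arcs_def)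
qed

text \<open>
  The \<open>w\<close> are the Durfee sizes of the partitions on the arrows. Expanding around
  \<open>u = max r c\<close>, everything reduces to \<open>(u - r) * (u - c) = 0\<close>.
\<close>

lemma euler_form_max_le:
  fixes r c :: "'a \<Rightarrow> int" and w :: "'b \<Rightarrow> int"
  assumes w: "\<And>a. a \<in> arcs G \<Longrightarrow> w a \<le> r (tail G a)" "\<And>a. a \<in> arcs G \<Longrightarrow> w a \<le> c (head G a)"
    and r: "\<And>x. x \<in> verts G \<Longrightarrow> r x \<le> (\<Sum>a\<in>out_arcs G x. w a)"
    and c: "\<And>x. x \<in> verts G \<Longrightarrow> c x \<le> (\<Sum>a\<in>in_arcs G x. w a)"
  shows "euler_form G (\<lambda>x. max (r x) (c x)) \<le>
    (\<Sum>x\<in>verts G. (r x)\<^sup>2 + (c x)\<^sup>2 - r x * c x) - (\<Sum>a\<in>arcs G. r (tail G a) * c (head G a))"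
proof -
  define u where "u x = max (r x) (c x)" for x
  \<comment> \<open>The lower bounds on the sums of \<open>w\<close> are weighted by the nonnegative
    defects \<open>u - r\<close> and \<open>u - c\<close>.\<close>
  have "(\<Sum>x\<in>verts G. (u x - r x) * r x + (u x - c x) * c x) \<le>
      (\<Sum>x\<in>verts G. (u x - r x) * (\<Sum>a\<in>out_arcs G x. w a) + (u x - c x) * (\<Sum>a\<in>in_arcs G x. w a))"
    by (intro sum_mono add_mono mult_left_mono) (auto simp: u_def r c)
  also have "\<dots> = (\<Sum>x\<in>verts G. \<Sum>a\<in>out_arcs G x. (u (tail G a) - r (tail G a)) * w a)
      + (\<Sum>x\<in>verts G. \<Sum>a\<in>in_arcs G x. (u (head G a) - c (head G a)) * w a)"
    by (simp add: sum.distrib sum_distrib_left out_arcs_def in_arcs_def)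
  also have "\<dots> = (\<Sum>a\<in>arcs G. (u (tail G a) - r (tail G a)) * w a + (u (head G a) - c (head G a)) * w a)"
    by (simp only: sum_out_arcs sum_in_arcs sum.distrib)
  also have "\<dots> \<le> (\<Sum>a\<in>arcs G. u (tail G a) * u (head G a) - r (tail G a) * c (head G a))"
  proof (rule sum_mono)
    fix a assume a: "a \<in> arcs G"
    let ?t = "tail G a" and ?h = "head G a"
    have u: "0 \<le> u ?t - r ?t" "0 \<le> u ?h - c ?h" by (auto simp: u_def)
    \<comment> \<open>Each defect is paired with the bound on \<open>w a\<close> from the opposite
      end of the arrow; adding the product of the two defects completes the expansion of
      \<open>u ?t * u ?h\<close>.\<close>
    have "(u ?t - r ?t) * w a + (u ?h - c ?h) * w a
        \<le> (u ?t - r ?t) * c ?h + (u ?h - c ?h) * r ?t"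
      using w[OF a] u by (intro add_mono mult_left_mono) auto
    also have "\<dots> \<le> (u ?t - r ?t) * c ?h + (u ?h - c ?h) * r ?t + (u ?t - r ?t) * (u ?h - c ?h)"
      using u by simp
    also have "\<dots> = u ?t * u ?h - r ?t * c ?h" by (simp add: algebra_simps)
    finally show "(u ?t - r ?t) * w a + (u ?h - c ?h) * w a \<le> u ?t * u ?h - r ?t * c ?h" .
  qed
  finally have "(\<Sum>x\<in>verts G. (u x - r x) * r x + (u x - c x) * c x)
      \<le> (\<Sum>a\<in>arcs G. u (tail G a) * u (head G a) - r (tail G a) * c (head G a))" .
  \<comment> \<open>This is equivalent to \<open>(u x - r x) * (u x - c x) = 0\<close>, which holds
    because the maximum is one of the two.\<close>
  moreover have "(u x - r x) * r x + (u x - c x) * c x = (u x)\<^sup>2 - ((r x)\<^sup>2 + (c x)\<^sup>2 - r x * c x)" for x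
    by (auto simp: u_def max_def algebra_simps power2_eq_square)
  ultimately show ?thesis
    by (simp add: euler_form_def u_def sum_subtractf)
qed

end

section \<open>Combining the vertex and arrow estimates\<close>

theorem theorem3p5:
  fixes Q :: "('v, 'a) pre_digraph"
    and \<beta> \<gamma> :: "'v \<Rightarrow> nat"
    and lam :: "'a \<Rightarrow> parts"
    and \<mu> \<nu> :: "'v \<Rightarrow> parts"
  assumes "fin_digraph Q"
    and "associated_collection Q \<beta> \<gamma> lam \<mu> \<nu>"
  shows "D_value Q \<beta> \<gamma> lam \<mu> \<nu> \<ge> ereal (real_of_int (euler_form Q (\<lambda>x. int (durfee_vector \<mu> \<nu> x))))"
proof -
  interpret fin_digraph Q by fact
  have lam: "is_partition (lam a)" if "a \<in> arcs Q" for a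
    using assms(2) that unfolding associated_collection_def by blast
  have \<mu>: "is_partition (\<mu> x)" "at_most_rows (\<mu> x) (\<beta> x)"
      "occurs_in_lr_product (out_arcs Q x) lam (\<mu> x)"
    and \<nu>: "is_partition (\<nu> x)" "at_most_rows (\<nu> x) (\<gamma> x)"
      "occurs_in_lr_product (in_arcs Q x) (\<lambda>a. conj_partition (lam a)) (\<nu> x)"
    if "x \<in> verts Q" for x
    using assms(2) that unfolding associated_collection_def by blast+
  define r where "r x = durfee (\<mu> x)" for x
  define c where "c x = durfee (\<nu> x)" for x
  define w where "w a = durfee (lam a)" for a
  define M where "M x = (\<Sum>q<r x. \<mu> x q)" for x
  define V where "V x = (\<Sum>i<c x. \<nu> x i)" for x
  \<comment> \<open>The upper bound for the length at \<open>x\<close> from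
    \<open>N_weight_vertex_weight_le\<close>.\<close>
  define B where "B x = int (M x) + int (V x) + int (r x) * int (c x) - (int (r x))\<^sup>2 - (int (c x))\<^sup>2" for x
  let ?P = "\<Sum>a\<in>arcs Q. psize (lam a)"
  \<comment> \<open>Conjugation preserves Durfee sizes, so one \<open>w a\<close> serves both ends
    of the arrow.\<close>
  have conj_w: "durfee (conj_partition (lam a)) = w a" if "a \<in> arcs Q" for a
    using durfee_conj_partition[OF lam[OF that]] by (simp add: w_def)
  have wr: "w a \<le> r (tail Q a)" if "a \<in> arcs Q" for a
    using occurs_in_lr_product_durfee_factor_le[OF \<mu>(3)[of "tail Q a"], of a] that
    by (simp add: w_def r_def)
  have wc: "w a \<le> c (head Q a)" if "a \<in> arcs Q" for a
    using occurs_in_lr_product_durfee_factor_le[OF \<nu>(3)[of "head Q a"], of a] that conj_w[OF that]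
    by (simp add: c_def)
  have rw: "r x \<le> (\<Sum>a\<in>out_arcs Q x. w a)" if "x \<in> verts Q" for x
    using occurs_in_lr_product_durfee_le[OF \<mu>(3)[OF that]] lam by (simp add: w_def r_def)
  have cw: "c x \<le> (\<Sum>a\<in>in_arcs Q x. w a)" if "x \<in> verts Q" for x
    using occurs_in_lr_product_durfee_le[OF \<nu>(3)[OF that]] lam conj_w
    by (simp add: c_def is_partition_conj_partition)
  have "euler_form Q (\<lambda>x. int (durfee_vector \<mu> \<nu> x)) =
      euler_form Q (\<lambda>x. max (int (r x)) (int (c x)))"
    by (simp add: durfee_vector_def r_def c_def of_nat_max)
  also have "\<dots> \<le> (\<Sum>x\<in>verts Q. (int (r x))\<^sup>2 + (int (c x))\<^sup>2 - int (r x) * int (c x))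
      - (\<Sum>a\<in>arcs Q. int (r (tail Q a)) * int (c (head Q a)))"
  proof (rule euler_form_max_le[where w = "\<lambda>a. int (w a)"])
    fix x assume "x \<in> verts Q"
    from rw[OF this] cw[OF this]
    show "int (r x) \<le> (\<Sum>a\<in>out_arcs Q x. int (w a))" "int (c x) \<le> (\<Sum>a\<in>in_arcs Q x. int (w a))"
      unfolding of_nat_sum[symmetric] of_nat_le_iff .
  qed (simp_all add: wr wc)
  also have "\<dots> = (\<Sum>x\<in>verts Q. int (M x) + int (V x)) - (\<Sum>x\<in>verts Q. B x)
      - (\<Sum>a\<in>arcs Q. int (r (tail Q a)) * int (c (head Q a)))"
    by (simp add: B_def sum.distrib sum_subtractf)
  also have "\<dots> \<le> int ?P - (\<Sum>x\<in>verts Q. B x)"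
  proof -
    \<comment> \<open>Writing \<open>r (tail Q a)\<close> for \<open>r x\<close> allows the double
      sum to be regrouped over arrows.\<close>
    have "(\<Sum>x\<in>verts Q. M x) \<le> (\<Sum>x\<in>verts Q. \<Sum>a\<in>out_arcs Q x. \<Sum>i<r (tail Q a). lam a i)"
    proof (rule sum_mono)
      fix x assume "x \<in> verts Q"
      then have "M x \<le> (\<Sum>a\<in>out_arcs Q x. \<Sum>i<r x. lam a i)"
        unfolding M_def by (intro occurs_in_lr_product_sum_rows_le \<mu>)
      then show "M x \<le> (\<Sum>a\<in>out_arcs Q x. \<Sum>i<r (tail Q a). lam a i)" by simp
    qed
    moreover have "(\<Sum>x\<in>verts Q. V x)
        \<le> (\<Sum>x\<in>verts Q. \<Sum>a\<in>in_arcs Q x. \<Sum>i<c (head Q a). conj_partition (lam a) i)"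
    proof (rule sum_mono)
      fix x assume "x \<in> verts Q"
      then have "V x \<le> (\<Sum>a\<in>in_arcs Q x. \<Sum>i<c x. conj_partition (lam a) i)"
        unfolding V_def by (intro occurs_in_lr_product_sum_rows_le \<nu>)
      then show "V x \<le> (\<Sum>a\<in>in_arcs Q x. \<Sum>i<c (head Q a). conj_partition (lam a) i)" by simp
    qed
    ultimately have "(\<Sum>x\<in>verts Q. M x) + (\<Sum>x\<in>verts Q. V x)
        \<le> (\<Sum>a\<in>arcs Q. (\<Sum>i<r (tail Q a). lam a i) + (\<Sum>i<c (head Q a). conj_partition (lam a) i))"
      unfolding sum_out_arcs sum_in_arcs sum.distrib by linarith
    \<comment> \<open>The overlap of rows and columns is exactly the arrow term subtracted in the
      goal.\<close>
    also have "\<dots> \<le> (\<Sum>a\<in>arcs Q. psize (lam a) + r (tail Q a) * c (head Q a))"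
      by (intro sum_mono rows_plus_columns_le lam)
    finally have "int ((\<Sum>x\<in>verts Q. M x) + (\<Sum>x\<in>verts Q. V x))
        \<le> int (\<Sum>a\<in>arcs Q. psize (lam a) + r (tail Q a) * c (head Q a))"
      by (rule of_nat_mono)
    then show ?thesis by (simp add: sum.distrib)
  qed
  finally have "ereal (real_of_int (euler_form Q (\<lambda>x. int (durfee_vector \<mu> \<nu> x))))
      \<le> ereal (real_of_int (int ?P - (\<Sum>x\<in>verts Q. B x)))"
    unfolding ereal_less_eq of_int_le_iff .
  also have "\<dots> = ereal (real ?P) - (\<Sum>x\<in>verts Q. ereal (real_of_int (B x)))"
    by simp
  also have "\<dots> \<le> D_value Q \<beta> \<gamma> lam \<mu> \<nu>"
    unfolding D_value_def
  proof (intro ereal_minus_mono sum_mono order_refl)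
    fix x assume "x \<in> verts Q"
    then show "N_weight (vertex_weight (\<gamma> x) (\<beta> x) (\<nu> x) (\<mu> x)) \<le> ereal (real_of_int (B x))"
      unfolding B_def M_def V_def r_def c_def by (intro N_weight_vertex_weight_le \<mu> \<nu>)
  qed
  finally show ?thesis .
qed

end
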